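(* Let $n\in\{2,3,4\}$, $\alpha=\sqrt{n}-1$, $\lambda\ge 0$, $c_0>0$, $c_1\in\mathbb{R}$ and $c_2:=\frac{(n-1)(\alpha-1)}{2}$. Let $\varepsilon>0$ and $h\in C^2((0,\infty))$ be the constant and the unique solution described in the context (the solution of the soliton equation on $(0,\infty)$ associated with $n,\lambda,c_0,c_1,\varepsilon$). Then there exists a constant $0<\delta_0<1$ such that for $0<r\le\delta_0$ $$h(r)=\frac{1}{r^{\alpha}}\left(c_0-\frac{c_2}{\alpha}r^{\alpha}-\frac{c_2(c_2+n-1)}{4c_0\alpha(1-\alpha)}r^{2\alpha}+o(1)r^{2\alpha}\right)\quad\text{if } n=2,3,$$ $$h(r)=\frac1r\left(c_0+\frac{\lambda}{4}r^2\log r+o(1)r^2|\log r|\right)\quad\text{if } n=4.$$ Moreover, for $0<r\le\delta_0$, $$h_r(r)=\frac{1}{r^{\alpha+1}}\left(-\alpha c_0-\frac{c_2(c_2+n-1)}{4c_0(1-\alpha)}r^{2\alpha}+o(1)r^{2\alpha}\right)\quad\text{if } n=2,3,$$ $$h_r(r)=\frac{1}{r^2}\left(-c_0+\frac{\lambda}{4}r^2\log r+o(1)r^2|\log r|\right)\quad\text{if } n=4.$$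
   Context: Subscripts $r$ denote derivatives with respect to $r$. Each $o(1)$ denotes a function of $r$ tending to $0$ as $r\to0^+$. The solution $h$: for the given parameters there exists a constant $\varepsilon>0$ for which there is a unique $h\in C^2((0,\infty))$ satisfying (i) $h(r)>0$ and $2r^2h(r)h_{rr}(r)=(n-1)h(r)(h(r)-1)+rh_r(r)\big(rh_r(r)-\lambda r-(n-1)\big)$ for all $r\in(0,\infty)$; (ii) $\lim_{r\to 0^+}r^{\alpha}h(r)=c_0$; (iii) the function $w(r)=r^{\alpha}h(r)$ satisfies, for all $0<r<\varepsilon$, $$w_r(r)=-c_2r^{\alpha-1}+c_1r^{\alpha}+\frac{\alpha\lambda}{2}r^{\alpha}\log r+r^{\alpha}\left\{\frac{n-1}{2}\int_r^{\varepsilon}\frac{\rho^{-1}w_r(\rho)}{w(\rho)}\,d\rho-\frac{\lambda}{2}\int_0^r\frac{w_r(\rho)}{w(\rho)}\,d\rho-\frac12\int_r^{\varepsilon}\frac{\rho^{-\alpha}w_r(\rho)^2}{w(\rho)}\,d\rho\right\}.$$ Such an $\varepsilon$ is fixed and $h$ denotes the corresponding unique function. *)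

theory Defs
  imports "HOL-Analysis.Analysis"
begin

text \<open>
  Only the values of \<open>h\<close> on \<open>(0,\<infinity>)\<close> matter. All integrals are Henstock--Kurzweil integrals; for the
  integral over \<open>(0,r)\<close>, whose integrand is in general unbounded near \<open>0\<close>, this is the improper integral.
\<close>

definition C2_on_pos :: "(real \<Rightarrow> real) \<Rightarrow> bool" where
  "C2_on_pos h \<longleftrightarrow> h C1_differentiable_on {0<..} \<and> deriv h C1_differentiable_on {0<..}"

definition soliton_ode :: "nat \<Rightarrow> real \<Rightarrow> (real \<Rightarrow> real) \<Rightarrow> bool" where
  "soliton_ode n lam h \<longleftrightarrow>
     (\<forall>r>0. h r > 0 \<and>
        2 * r^2 * h r * deriv (deriv h) r =
          (real n - 1) * h r * (h r - 1)
            + r * deriv h r * (r * deriv h r - lam * r - (real n - 1)))"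

definition soliton_integral_eq ::
  "nat \<Rightarrow> real \<Rightarrow> real \<Rightarrow> real \<Rightarrow> real \<Rightarrow> real \<Rightarrow> (real \<Rightarrow> real) \<Rightarrow> bool" where
  "soliton_integral_eq n \<alpha> lam c1 c2 \<epsilon> w \<longleftrightarrow>
     (\<forall>r. 0 < r \<and> r < \<epsilon> \<longrightarrow>
        (\<lambda>\<rho>. deriv w \<rho> / w \<rho>) integrable_on {0..r} \<and>
        deriv w r =
          - c2 * r powr (\<alpha> - 1) + c1 * r powr \<alpha> + \<alpha> * lam / 2 * r powr \<alpha> * ln r
          + r powr \<alpha> *
              ((real n - 1) / 2 * integral {r..\<epsilon>} (\<lambda>\<rho>. \<rho> powr (-1) * deriv w \<rho> / w \<rho>)
               - lam / 2 * integral {0..r} (\<lambda>\<rho>. deriv w \<rho> / w \<rho>)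
               - 1 / 2 * integral {r..\<epsilon>} (\<lambda>\<rho>. \<rho> powr (- \<alpha>) * (deriv w \<rho>)^2 / w \<rho>)))"

definition soliton_solution ::
  "nat \<Rightarrow> real \<Rightarrow> real \<Rightarrow> real \<Rightarrow> real \<Rightarrow> real \<Rightarrow> real \<Rightarrow> (real \<Rightarrow> real) \<Rightarrow> bool" where
  "soliton_solution n \<alpha> lam c0 c1 c2 \<epsilon> h \<longleftrightarrow>
     C2_on_pos h \<and>
     soliton_ode n lam h \<and>
     ((\<lambda>r. r powr \<alpha> * h r) \<longlongrightarrow> c0) (at_right 0) \<and>
     soliton_integral_eq n \<alpha> lam c1 c2 \<epsilon> (\<lambda>r. r powr \<alpha> * h r)"

end

theory Submission
  imports Defs "HOL-Real_Asymp.Real_Asymp"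
begin

text \<open>
  The differential equation and the limit of \<open>w = r\<^sup>\<alpha> h\<close> alone determine the expansion. The function
  \<open>y = r\<^sup>1\<^sup>-\<^sup>\<alpha> w'\<close> satisfies
  \<open>r y' = (1 + r\<^sup>\<alpha> (y - (n - 1) - \<lambda> r) / (2 w)) y + c2 + \<alpha> \<lambda> r / 2\<close>. Since \<open>w\<close> converges, \<open>r w' = r\<^sup>\<alpha> y\<close>
  is small at arbitrarily small \<open>r\<close>, and a barrier argument keeps it small on a whole interval \<open>(0, b)\<close>.
  There the coefficient of \<open>y\<close> is at least \<open>1/2\<close>, so a second barrier bounds \<open>y\<close>. The expansion of
  \<open>v = y / r\<close>, and then that of \<open>w\<close>, follow by l'Hopital's rule.
\<close>

section \<open>A one-sided barrier principle\<close>

text \<open>If \<open>g\<close> exceeded \<open>N\<close> at \<open>r\<close>, let \<open>s\<close>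
  be the first point to the right of \<open>r\<close> with \<open>g s \<le> N\<close>; it exists
  because \<open>g b \<le> N\<close>. By continuity \<open>g s = N\<close>, so
  \<open>g' s > 0\<close> and \<open>g\<close> lies below \<open>N\<close> just to the left of
  \<open>s\<close>, against the choice of \<open>s\<close>.\<close>

lemma barrier_to_the_left:
  fixes g :: "real \<Rightarrow> real"
  assumes deriv: "\<And>r. a < r \<Longrightarrow> r \<le> b \<Longrightarrow> (g has_real_derivative g' r) (at r)"
    and strict: "\<And>r. a < r \<Longrightarrow> r \<le> b \<Longrightarrow> g r = N \<Longrightarrow> g' r > 0"
    and start: "g b \<le> N" and r: "a < r" "r \<le> b"
  shows "g r \<le> N"
proof (rule ccontr)
  assume "\<not> g r \<le> N"
  then have gr: "g r > N" by simp
  have cont: "continuous_on {r..b} g"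
    using r by (intro continuous_at_imp_continuous_on ballI DERIV_isCont[OF deriv]) auto
  define S where "S = {t \<in> {r..b}. g t \<le> N}"
  have "compact S"
  proof -
    have "closed S"
      unfolding S_def using continuous_closed_preimage[OF cont, of "{..N}"]
      by (simp add: vimage_def Int_def)
    moreover have "bounded S"
      by (rule bounded_subset[of "{r..b}"]) (auto simp: S_def)
    ultimately show ?thesis by (simp add: compact_eq_bounded_closed)
  qed
  moreover have "S \<noteq> {}" using start r by (auto simp: S_def)
  ultimately obtain s where s: "s \<in> S" "\<And>t. t \<in> S \<Longrightarrow> s \<le> t"
    using compact_attains_inf by metis
  have above: "g t > N" if "r \<le> t" "t < s" for t
    using s(2)[of t] s(1) that by (force simp: S_def)
  have rs: "r < s" using s(1) gr by (cases "r = s") (auto simp: S_def)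
  have "g s = N"
  proof (rule antisym)
    show "g s \<le> N" using s(1) by (simp add: S_def)
    have "(g \<longlongrightarrow> g s) (at_left s)"
      using DERIV_isCont[OF deriv[of s]] s(1) r
      by (simp add: S_def isCont_def filterlim_at_split)
    moreover have "\<forall>\<^sub>F t in at_left s. N \<le> g t"
      using eventually_at_left_real[OF rs] by eventually_elim (auto intro!: less_imp_le above)
    ultimately show "N \<le> g s"
      by (intro tendsto_lowerbound) auto
  qed
  then have "g' s > 0" using strict[of s] s(1) r by (auto simp: S_def)
  then obtain d where d: "d > 0" "\<And>h. 0 < h \<Longrightarrow> h < d \<Longrightarrow> g (s - h) < g s"
    using DERIV_pos_inc_left[OF deriv[of s]] s(1) r by (auto simp: S_def)
  \<comment> \<open>The minimum keeps \<open>s - h\<close> both in the range where \<open>g\<close>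
    is below \<open>g s\<close> and in \<open>{r..<s}\<close>, where \<open>g\<close> is above
    \<open>N\<close>.\<close>
  define h where "h = min (d / 2) (s - r)"
  have "0 < h" "h < d" "r \<le> s - h" using d(1) rs by (auto simp: h_def)
  then show False using d(2)[of h] above[of "s - h"] \<open>g s = N\<close> by simp
qed

section \<open>The first-order system for \<open>w\<close> and \<open>y\<close>, and bounds near
  0\<close>

text \<open>The singular system at 0, stated apart from \<open>h\<close>; in the application
  \<open>m\<close> is \<open>real n - 1\<close>.\<close>

locale soliton_profile =
  fixes \<alpha> lam c0 c2 m :: real and w y :: "real \<Rightarrow> real"
  assumes \<alpha>_pos: "\<alpha> > 0" and c0_pos: "c0 > 0"
    and w_pos: "\<And>r. r > 0 \<Longrightarrow> w r > 0"
    and w_deriv: "\<And>r. r > 0 \<Longrightarrow> (w has_real_derivative r powr (\<alpha> - 1) * y r) (at r)"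
    and y_deriv: "\<And>r. r > 0 \<Longrightarrow> (y has_real_derivative
        ((1 + r powr \<alpha> * (y r - m - lam * r) / (2 * w r)) * y r + c2 + \<alpha> * lam * r / 2) / r) (at r)"
    and w_lim: "(w \<longlongrightarrow> c0) (at_right 0)"
begin

text \<open>With \<open>forcing\<close> below, the second equation reads r y' = \<open>rate\<close>
  y + \<open>forcing\<close>: both barriers rest on a positive lower bound for
  \<open>rate\<close>.\<close>

definition rate :: "real \<Rightarrow> real" where
  "rate r = 1 + r powr \<alpha> * (y r - m - lam * r) / (2 * w r)"

definition forcing :: "real \<Rightarrow> real" where
  "forcing r = c2 + \<alpha> * lam * r / 2"

lemma y_deriv': "r > 0 \<Longrightarrow> (y has_real_derivative (rate r * y r + forcing r) / r) (at r)"
  using y_deriv[of r] by (simp add: rate_def forcing_def add.assoc)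

lemma powr_\<alpha>_lim: "((\<lambda>r::real. r powr \<alpha>) \<longlongrightarrow> 0) (at_right 0)"
  using \<alpha>_pos by real_asymp

text \<open>The mean value theorem on \<open>[r/2, r]\<close>: the increment of \<open>w\<close> tends to \<open>0\<close>.\<close>

lemma small_slope_frequently:
  assumes "\<eta> > 0" "R > 0"
  shows "\<exists>r. 0 < r \<and> r < R \<and> \<bar>r powr \<alpha> * y r\<bar> < \<eta>"
proof -
  have "((\<lambda>r. w (r / 2)) \<longlongrightarrow> c0) (at_right 0)"
    by (rule filterlim_compose[OF w_lim]) real_asymp
  then have "((\<lambda>r. w r - w (r / 2)) \<longlongrightarrow> c0 - c0) (at_right 0)"
    by (intro tendsto_diff w_lim)
  then have "\<forall>\<^sub>F r in at_right 0. \<bar>w r - w (r / 2)\<bar> < \<eta> / 2"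
    using tendstoD[of _ "c0 - c0" _ "\<eta> / 2"] assms(1) by (simp add: dist_real_def)
  moreover have "\<forall>\<^sub>F r in at_right 0. r \<in> {0<..<R}"
    using assms(2) by (rule eventually_at_right_real)
  ultimately have "\<forall>\<^sub>F r in at_right 0. \<bar>w r - w (r / 2)\<bar> < \<eta> / 2 \<and> r \<in> {0<..<R}"
    by (rule eventually_conj)
  then obtain r where r: "\<bar>w r - w (r / 2)\<bar> < \<eta> / 2" "0 < r" "r < R"
    using eventually_happens'[OF trivial_limit_at_right_real] by fastforce
  obtain s where s: "r / 2 < s" "s < r"
      "w r - w (r / 2) = (r - r / 2) * (s powr (\<alpha> - 1) * y s)"
    using MVT2[of "r / 2" r w "\<lambda>s. s powr (\<alpha> - 1) * y s"] w_deriv r by auto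
  \<comment> \<open>The slope at \<open>s\<close> is s w'(s), at most r |w'(s)| in absolute value;
    since the interval has length r/2, this is twice the increment of \<open>w\<close>.\<close>
  have "s powr \<alpha> = s * s powr (\<alpha> - 1)"
    using s r by (simp add: powr_diff)
  then have "\<bar>s powr \<alpha> * y s\<bar> = s * \<bar>s powr (\<alpha> - 1) * y s\<bar>"
    using s r by (simp add: abs_mult)
  also have "\<dots> \<le> r * \<bar>s powr (\<alpha> - 1) * y s\<bar>"
    using s by (intro mult_right_mono) auto
  also have "\<dots> = 2 * \<bar>w r - w (r / 2)\<bar>"
    unfolding s(3) using r by (simp add: abs_mult)
  also have "\<dots> < \<eta>" using r by simp
  finally show ?thesis using s r by (intro exI[of _ s]) auto
qed

text \<open>The slope \<open>x = r w'\<close> satisfies \<open>r x' = (\<alpha> + rate) x + r\<^sup>\<alpha> forcing\<close>. As long as \<open>\<bar>x\<bar> \<le> c0 / 4\<close>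
  the rate is at least \<open>1/2\<close>, so \<open>\<bar>x\<bar> = c0 / 4\<close> cannot be crossed upwards as \<open>r\<close> decreases.\<close>

lemma rate_lower_bound:
  "\<forall>\<^sub>F r in at_right 0. \<bar>r powr \<alpha> * y r\<bar> \<le> c0 / 4 \<longrightarrow> rate r \<ge> 1 / 2"
proof -
  have "((\<lambda>r. r powr \<alpha> * (m + lam * r)) \<longlongrightarrow> 0 * (m + lam * 0)) (at_right 0)"
    by (intro tendsto_intros powr_\<alpha>_lim)
  then have "\<forall>\<^sub>F r in at_right 0. \<bar>r powr \<alpha> * (m + lam * r)\<bar> < c0 / 4"
    using tendstoD[of _ "0 * (m + lam * 0)" _ "c0 / 4"] c0_pos by (simp add: dist_real_def)
  moreover have "\<forall>\<^sub>F r in at_right 0. w r > c0 / 2"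
    using w_lim c0_pos by (intro order_tendstoD) auto
  ultimately show ?thesis
  proof eventually_elim
    case (elim r)
    show ?case
    proof
      assume x: "\<bar>r powr \<alpha> * y r\<bar> \<le> c0 / 4"
      \<comment> \<open>Each of the two terms is at most c0/4 in absolute value and
        \<open>w r\<close> exceeds c0/2, so the fraction in \<open>rate\<close> is at least
        -1/2.\<close>
      have "r powr \<alpha> * (y r - m - lam * r) = r powr \<alpha> * y r - r powr \<alpha> * (m + lam * r)"
        by (simp add: algebra_simps)
      then have "r powr \<alpha> * (y r - m - lam * r) \<ge> - w r"
        using x elim by linarith
      then show "rate r \<ge> 1 / 2"
        using elim c0_pos by (simp add: rate_def field_simps)
    qed
  qed
qed

text \<open>The mean value argument supplies one point \<open>b\<close> where the bound holds
  strictly; the barrier principle carries it to all smaller radii.\<close>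

lemma slope_bound: "\<forall>\<^sub>F r in at_right 0. \<bar>r powr \<alpha> * y r\<bar> \<le> c0 / 4"
proof -
  have "((\<lambda>r. r powr \<alpha> * (c2 + \<alpha> * lam * r / 2)) \<longlongrightarrow> 0 * (c2 + \<alpha> * lam * 0 / 2)) (at_right 0)"
    by (intro tendsto_intros powr_\<alpha>_lim) auto
  \<comment> \<open>On the barrier |x| = c0/4 the growth term is at least x^2/2 = (c0/4)(c0/8), so
    c0/8 is the bound that lets it dominate the forcing term.\<close>
  then have "\<forall>\<^sub>F r in at_right 0. \<bar>r powr \<alpha> * forcing r\<bar> < c0 / 8"
    using tendstoD[of _ "0 * (c2 + \<alpha> * lam * 0 / 2)" _ "c0 / 8"] c0_pos
    by (simp add: dist_real_def forcing_def)
  then have "\<forall>\<^sub>F r in at_right 0. \<bar>r powr \<alpha> * forcing r\<bar> < c0 / 8 \<and>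
      (\<bar>r powr \<alpha> * y r\<bar> \<le> c0 / 4 \<longrightarrow> rate r \<ge> 1 / 2)"
    using rate_lower_bound by eventually_elim auto
  then obtain R where R: "R > 0" "\<And>r. 0 < r \<Longrightarrow> r < R \<Longrightarrow> \<bar>r powr \<alpha> * forcing r\<bar> < c0 / 8"
      "\<And>r. 0 < r \<Longrightarrow> r < R \<Longrightarrow> \<bar>r powr \<alpha> * y r\<bar> \<le> c0 / 4 \<Longrightarrow> rate r \<ge> 1 / 2"
    by (auto simp: eventually_at_right_field)
  obtain b where b: "0 < b" "b < R" "\<bar>b powr \<alpha> * y b\<bar> < c0 / 4"
    using small_slope_frequently[of "c0 / 4" R] c0_pos R(1) by auto
  define x where "x r = r powr \<alpha> * y r" for r
  define x' where "x' r = ((\<alpha> + rate r) * x r + r powr \<alpha> * forcing r) / r" for r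
  have dx: "(x has_real_derivative x' r) (at r)" if "r > 0" for r
    unfolding x_def[abs_def] x'_def using that
    by (auto intro!: derivative_eq_intros y_deriv' simp: powr_diff field_simps)
  \<comment> \<open>Squaring treats the barriers c0/4 and -c0/4 at once.\<close>
  have "(x r)\<^sup>2 \<le> (c0 / 4)\<^sup>2" if "0 < r" "r \<le> b" for r
  proof (rule barrier_to_the_left[where a = 0 and b = b and g = "\<lambda>r. (x r)\<^sup>2"
      and g' = "\<lambda>r. 2 * x r * x' r"])
    show "((\<lambda>r. (x r)\<^sup>2) has_real_derivative 2 * x s * x' s) (at s)" if "0 < s" for s
      using dx[OF that] by (auto intro!: derivative_eq_intros)
    show "2 * x s * x' s > 0" if s: "0 < s" "s \<le> b" "(x s)\<^sup>2 = (c0 / 4)\<^sup>2" for s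
    proof -
      have abs: "\<bar>x s\<bar> = c0 / 4"
        using s(3) c0_pos by (auto simp: power2_eq_iff)
      have f: "\<bar>s powr \<alpha> * forcing s\<bar> < c0 / 8" and "rate s \<ge> 1 / 2"
        using R(2,3)[of s] s b abs by (auto simp: x_def)
      then have "(\<alpha> + rate s) * (x s)\<^sup>2 \<ge> 1 / 2 * (x s)\<^sup>2"
        using \<alpha>_pos by (intro mult_right_mono) auto
      moreover have "\<bar>x s * (s powr \<alpha> * forcing s)\<bar> < c0 / 4 * (c0 / 8)"
        unfolding abs_mult[of "x s"] abs using f c0_pos by (intro mult_strict_left_mono) auto
      ultimately have "0 < (\<alpha> + rate s) * (x s)\<^sup>2 + x s * (s powr \<alpha> * forcing s)"
        unfolding s(3) by (simp add: power2_eq_square)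
      also have "\<dots> = s * (x s * x' s)"
        using s by (simp add: x'_def field_simps power2_eq_square)
      finally show ?thesis using s by (simp add: zero_less_mult_iff)
    qed
    show "(x b)\<^sup>2 \<le> (c0 / 4)\<^sup>2"
      using b c0_pos by (intro abs_le_square_iff[THEN iffD1]) (simp add: x_def)
  qed (use that in auto)
  then have "\<bar>x r\<bar> \<le> c0 / 4" if "0 < r" "r \<le> b" for r
    using that c0_pos abs_le_square_iff[of "x r" "c0 / 4"] by simp
  then show ?thesis
    using b(1) unfolding x_def eventually_at_right_field by (intro exI[of _ b]) auto
qed

text \<open>By \<open>slope_bound\<close> the estimate \<open>rate r \<ge> 1 / 2\<close> now holds
  unconditionally near 0. The barrier argument then applies to \<open>y\<close> itself, without the
  weight \<open>r powr \<alpha>\<close>.\<close>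

lemma y_bounded: "\<exists>B. \<forall>\<^sub>F r in at_right 0. \<bar>y r\<bar> \<le> B"
proof -
  define K where "K = \<bar>c2\<bar> + 1"
  have "(forcing \<longlongrightarrow> c2 + \<alpha> * lam * 0 / 2) (at_right 0)"
    unfolding forcing_def[abs_def] by (intro tendsto_intros) auto
  then have "\<forall>\<^sub>F r in at_right 0. \<bar>forcing r - c2\<bar> < 1"
    using tendstoD[of _ "c2 + \<alpha> * lam * 0 / 2" _ 1] by (simp add: dist_real_def)
  with slope_bound rate_lower_bound
  have "\<forall>\<^sub>F r in at_right 0. rate r \<ge> 1 / 2 \<and> \<bar>forcing r\<bar> \<le> K"
    by eventually_elim (auto simp: K_def)
  then obtain R where R: "R > 0" "\<And>r. 0 < r \<Longrightarrow> r < R \<Longrightarrow> rate r \<ge> 1 / 2"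
      "\<And>r. 0 < r \<Longrightarrow> r < R \<Longrightarrow> \<bar>forcing r\<bar> \<le> K"
    by (auto simp: eventually_at_right_field)
  define b where "b = R / 2"
  have b: "0 < b" "b < R" using R(1) by (auto simp: b_def)
  \<comment> \<open>The first entry starts the barrier at \<open>b\<close>; the second makes B^2/2
    exceed B K, the largest possible contribution of the forcing when |y| = B.\<close>
  define B where "B = max \<bar>y b\<bar> (2 * K + 1)"
  have B: "\<bar>y b\<bar> \<le> B" "2 * K < B" "B > 0" by (auto simp: B_def K_def)
  define y' where "y' r = (rate r * y r + forcing r) / r" for r
  have "(y r)\<^sup>2 \<le> B\<^sup>2" if "0 < r" "r \<le> b" for r
  proof (rule barrier_to_the_left[where a = 0 and b = b and g = "\<lambda>r. (y r)\<^sup>2"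
      and g' = "\<lambda>r. 2 * y r * y' r"])
    show "((\<lambda>r. (y r)\<^sup>2) has_real_derivative 2 * y s * y' s) (at s)" if "0 < s" for s
      using y_deriv'[OF that] by (auto intro!: derivative_eq_intros simp: y'_def)
    show "2 * y s * y' s > 0" if s: "0 < s" "s \<le> b" "(y s)\<^sup>2 = B\<^sup>2" for s
    proof -
      have abs: "\<bar>y s\<bar> = B"
        using s(3) B(3) by (auto simp: power2_eq_iff)
      have "rate s * (y s)\<^sup>2 \<ge> 1 / 2 * (y s)\<^sup>2"
        using R(2)[of s] s b by (intro mult_right_mono) auto
      moreover have "\<bar>y s * forcing s\<bar> \<le> B * K"
        unfolding abs_mult abs using R(3)[of s] s b B(3) by (intro mult_left_mono) auto
      moreover have "B * K < 1 / 2 * B\<^sup>2"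
        using B(2,3) by (simp add: power2_eq_square)
      ultimately have "0 < rate s * (y s)\<^sup>2 + y s * forcing s"
        unfolding s(3) by linarith
      also have "\<dots> = s * (y s * y' s)"
        using s by (simp add: y'_def field_simps power2_eq_square)
      finally show ?thesis using s by (simp add: zero_less_mult_iff)
    qed
    show "(y b)\<^sup>2 \<le> B\<^sup>2"
      using B by (intro abs_le_square_iff[THEN iffD1]) auto
  qed (use that in auto)
  then have "\<bar>y r\<bar> \<le> B" if "0 < r" "r \<le> b" for r
    using that B(3) abs_le_square_iff[of "y r" B] by simp
  then show ?thesis
    using b(1) unfolding eventually_at_right_field by (intro exI[of _ B] exI[of _ b]) auto
qed

section \<open>The limit of \<open>y\<close>\<close>

text \<open>Division by \<open>r\<close> removes the leading part r y' = y of the equation, so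
  \<open>y\<close> enters v' only through \<open>Q\<close>. Moreover w' = r^\<alpha> v.\<close>

definition v :: "real \<Rightarrow> real" where
  "v r = y r / r"

text \<open>The nonlinear remainder: r y' = y + r^\<alpha> Q + \<open>forcing\<close>.\<close>

definition Q :: "real \<Rightarrow> real" where
  "Q r = (y r - m - lam * r) * y r / (2 * w r)"

lemma v_deriv:
  assumes "r > 0"
  shows "(v has_real_derivative r powr \<alpha> * Q r / r\<^sup>2 + c2 / r\<^sup>2 + \<alpha> * lam / (2 * r)) (at r)"
proof -
  have "w r \<noteq> 0" using w_pos[OF assms] by simp
  then show ?thesis
    unfolding v_def[abs_def] Q_def using assms
    by (auto intro!: derivative_eq_intros y_deriv simp: field_simps power2_eq_square)
qed

lemma w_deriv_v:
  assumes "r > 0"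
  shows "(w has_real_derivative r powr \<alpha> * v r) (at r)"
  using w_deriv[OF assms] assms by (simp add: v_def powr_diff)

text \<open>Boundedness of \<open>y\<close> gives r^\<alpha> Q -> 0, hence r^2 v' -> c2, and
  l'Hopital applies to y = v / (1/r).\<close>

lemma y_lim: "(y \<longlongrightarrow> - c2) (at_right 0)"
proof -
  obtain B where "\<forall>\<^sub>F r in at_right 0. \<bar>y r\<bar> \<le> B" using y_bounded by auto
  then have bdd: "Bfun y (at_right 0)"
    by (intro BfunI[of _ B]) auto
  have "((\<lambda>r. r powr \<alpha> * y r) \<longlongrightarrow> 0) (at_right 0)"
    using bounded_bilinear.Zfun_prod_Bfun[OF bounded_bilinear_mult _ bdd] powr_\<alpha>_lim
    by (simp add: tendsto_Zfun_iff)
  moreover from this have "((\<lambda>r. r powr \<alpha> * y r * y r) \<longlongrightarrow> 0) (at_right 0)"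
    using bounded_bilinear.Zfun_prod_Bfun[OF bounded_bilinear_mult _ bdd]
    by (simp add: tendsto_Zfun_iff)
  ultimately have "((\<lambda>r. (r powr \<alpha> * y r * y r - r powr \<alpha> * y r * (m + lam * r)) / (2 * w r))
      \<longlongrightarrow> (0 - 0 * (m + lam * 0)) / (2 * c0)) (at_right 0)"
    using c0_pos by (intro tendsto_intros w_lim) auto
  then have "((\<lambda>r. r powr \<alpha> * Q r) \<longlongrightarrow> 0) (at_right 0)"
    by (simp add: Q_def algebra_simps)
  then have lim: "((\<lambda>r. - (r powr \<alpha> * Q r) - c2 - \<alpha> * lam * r / 2) \<longlongrightarrow> - 0 - c2 - \<alpha> * lam * 0 / 2)
      (at_right 0)"
    by (intro tendsto_intros) auto
  \<comment> \<open>In this form of l'Hopital only the denominator has to tend to infinity; nothing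
    about the size of \<open>v\<close> enters.\<close>
  have "((\<lambda>r. v r / (1 / r)) \<longlongrightarrow> - c2) (at_right 0)"
  proof (rule lhopital_right_0_at_top)
    show "LIM r at_right 0. 1 / r :> (at_top :: real filter)" by real_asymp
    show "\<forall>\<^sub>F r in at_right 0. - 1 / (r\<^sup>2 :: real) \<noteq> 0"
      using eventually_at_right_less[of 0] by eventually_elim auto
    show "\<forall>\<^sub>F r in at_right 0. (v has_real_derivative
        r powr \<alpha> * Q r / r\<^sup>2 + c2 / r\<^sup>2 + \<alpha> * lam / (2 * r)) (at r)"
      using eventually_at_right_less[of 0] by eventually_elim (rule v_deriv)
    show "\<forall>\<^sub>F r in at_right 0. ((\<lambda>r::real. 1 / r) has_real_derivative - 1 / r\<^sup>2) (at r)"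
      using eventually_at_right_less[of 0]
      by eventually_elim (auto intro!: derivative_eq_intros simp: power2_eq_square)
    have "\<forall>\<^sub>F r in at_right 0. - (r powr \<alpha> * Q r) - c2 - \<alpha> * lam * r / 2 =
        (r powr \<alpha> * Q r / r\<^sup>2 + c2 / r\<^sup>2 + \<alpha> * lam / (2 * r)) / (- 1 / r\<^sup>2)"
      using eventually_at_right_less[of 0]
      by eventually_elim (auto simp: field_simps power2_eq_square)
    with lim show "((\<lambda>r. (r powr \<alpha> * Q r / r\<^sup>2 + c2 / r\<^sup>2 + \<alpha> * lam / (2 * r)) / (- 1 / r\<^sup>2))
        \<longlongrightarrow> - c2) (at_right 0)"
      by (auto intro: Lim_transform_eventually)
  qed
  moreover have "\<forall>\<^sub>F r in at_right 0. v r / (1 / r) = y r"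
    using eventually_at_right_less[of 0] by eventually_elim (simp add: v_def)
  ultimately show ?thesis by (rule Lim_transform_eventually)
qed

lemma Q_lim: "(Q \<longlongrightarrow> c2 * (c2 + m) / (2 * c0)) (at_right 0)"
proof -
  have "(Q \<longlongrightarrow> (- c2 - m - lam * 0) * - c2 / (2 * c0)) (at_right 0)"
    unfolding Q_def[abs_def] using c0_pos by (intro tendsto_intros y_lim w_lim) auto
  then show ?thesis by (simp add: algebra_simps)
qed

section \<open>The power expansion for \<alpha> < 1\<close>

text \<open>Adding c2/r cancels the term c2/r^2 of v'. What remains is r^(\<alpha>-2) times Q +
  (\<alpha> lam / 2) r^(1-\<alpha>), to be compared with the derivative of r^(\<alpha>-1). As
  \<alpha> < 1, the comparison function blows up and the \<open>lam\<close> term vanishes in the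
  limit.\<close>

lemma v_second_order:
  assumes "\<alpha> < 1"
  shows "((\<lambda>r. (v r + c2 / r) / r powr (\<alpha> - 1)) \<longlongrightarrow> - (c2 * (c2 + m) / (2 * c0 * (1 - \<alpha>))))
    (at_right 0)"
proof (rule lhopital_right_0_at_top)
  let ?f = "\<lambda>r. r powr \<alpha> * Q r / r\<^sup>2 + c2 / r\<^sup>2 + \<alpha> * lam / (2 * r) - c2 / r\<^sup>2"
  let ?g = "\<lambda>r::real. (\<alpha> - 1) * r powr (\<alpha> - 2)"
  show "LIM r at_right 0. r powr (\<alpha> - 1) :> (at_top :: real filter)"
    using assms by real_asymp
  show "\<forall>\<^sub>F r in at_right 0. ?g r \<noteq> 0"
    using eventually_at_right_less[of 0] by eventually_elim (use assms in auto)
  show "\<forall>\<^sub>F r in at_right 0. ((\<lambda>r. v r + c2 / r) has_real_derivative ?f r) (at r)"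
    using eventually_at_right_less[of 0]
    by eventually_elim (auto intro!: derivative_eq_intros v_deriv simp: power2_eq_square)
  show "\<forall>\<^sub>F r in at_right 0. ((\<lambda>r::real. r powr (\<alpha> - 1)) has_real_derivative ?g r) (at r)"
    using eventually_at_right_less[of 0]
  proof eventually_elim
    case (elim r)
    show ?case using has_real_derivative_powr[OF elim, of "\<alpha> - 1"] by simp
  qed
  have "((\<lambda>r::real. r powr (1 - \<alpha>)) \<longlongrightarrow> 0) (at_right 0)"
    using assms by real_asymp
  then have lim: "((\<lambda>r. (Q r + \<alpha> * lam / 2 * r powr (1 - \<alpha>)) / (\<alpha> - 1)) \<longlongrightarrow>
      (c2 * (c2 + m) / (2 * c0) + \<alpha> * lam / 2 * 0) / (\<alpha> - 1)) (at_right 0)"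
    using assms by (intro tendsto_intros Q_lim) auto
  have eq: "(c2 * (c2 + m) / (2 * c0) + \<alpha> * lam / 2 * 0) / (\<alpha> - 1) =
      - (c2 * (c2 + m) / (2 * c0 * (1 - \<alpha>)))"
    using assms c0_pos by (simp add: field_simps)
  have ev: "\<forall>\<^sub>F r in at_right 0. (Q r + \<alpha> * lam / 2 * r powr (1 - \<alpha>)) / (\<alpha> - 1) = ?f r / ?g r"
    using eventually_at_right_less[of 0]
  proof eventually_elim
    case (elim r)
    have "?f r = (Q r + \<alpha> * lam / 2 * r powr (1 - \<alpha>)) * r powr (\<alpha> - 2)"
      using elim by (simp add: powr_diff field_simps power2_eq_square)
    then show ?case using elim by simp
  qed
  show "((\<lambda>r. ?f r / ?g r) \<longlongrightarrow> - (c2 * (c2 + m) / (2 * c0 * (1 - \<alpha>)))) (at_right 0)"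
    by (rule Lim_transform_eventually[OF _ ev]) (use lim in \<open>simp only: eq\<close>)
qed

text \<open>The numerator has derivative r^\<alpha> (v + c2/r) and the denominator 2 \<alpha>
  r^\<alpha> r^(\<alpha>-1), so the quotient of derivatives is that of \<open>v_second_order\<close>
  divided by 2 \<alpha>.\<close>

lemma w_second_order:
  assumes "\<alpha> < 1"
  shows "((\<lambda>r. (w r - c0 + c2 / \<alpha> * r powr \<alpha>) / r powr (2 * \<alpha>)) \<longlongrightarrow>
    - (c2 * (c2 + m) / (4 * c0 * \<alpha> * (1 - \<alpha>)))) (at_right 0)"
proof (rule lhopital_right_0)
  let ?f = "\<lambda>r. r powr \<alpha> * v r + c2 * r powr (\<alpha> - 1)"
  let ?g = "\<lambda>r::real. 2 * \<alpha> * r powr (2 * \<alpha> - 1)"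
  have "((\<lambda>r. w r - c0 + c2 / \<alpha> * r powr \<alpha>) \<longlongrightarrow> c0 - c0 + c2 / \<alpha> * 0) (at_right 0)"
    by (intro tendsto_intros w_lim powr_\<alpha>_lim)
  then show "((\<lambda>r. w r - c0 + c2 / \<alpha> * r powr \<alpha>) \<longlongrightarrow> 0) (at_right 0)" by simp
  show "((\<lambda>r::real. r powr (2 * \<alpha>)) \<longlongrightarrow> 0) (at_right 0)"
    using \<alpha>_pos by real_asymp
  show "\<forall>\<^sub>F r in at_right 0. (r::real) powr (2 * \<alpha>) \<noteq> 0"
    using eventually_at_right_less[of 0] by eventually_elim auto
  show "\<forall>\<^sub>F r in at_right 0. ?g r \<noteq> 0"
    using eventually_at_right_less[of 0] by eventually_elim (use \<alpha>_pos in auto)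
  show "\<forall>\<^sub>F r in at_right 0. ((\<lambda>r. w r - c0 + c2 / \<alpha> * r powr \<alpha>) has_real_derivative ?f r) (at r)"
    using eventually_at_right_less[of 0]
    by eventually_elim (use \<alpha>_pos in \<open>auto intro!: derivative_eq_intros w_deriv_v\<close>)
  show "\<forall>\<^sub>F r in at_right 0. ((\<lambda>r::real. r powr (2 * \<alpha>)) has_real_derivative ?g r) (at r)"
    using eventually_at_right_less[of 0]
    by eventually_elim (auto intro!: derivative_eq_intros)
  have lim: "((\<lambda>r. (v r + c2 / r) / r powr (\<alpha> - 1) / (2 * \<alpha>)) \<longlongrightarrow>
      - (c2 * (c2 + m) / (2 * c0 * (1 - \<alpha>))) / (2 * \<alpha>)) (at_right 0)"
    using \<alpha>_pos by (intro tendsto_intros v_second_order assms) auto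
  have eq: "- (c2 * (c2 + m) / (2 * c0 * (1 - \<alpha>))) / (2 * \<alpha>) =
      - (c2 * (c2 + m) / (4 * c0 * \<alpha> * (1 - \<alpha>)))"
    using assms c0_pos \<alpha>_pos by (simp add: field_simps)
  have ev: "\<forall>\<^sub>F r in at_right 0. (v r + c2 / r) / r powr (\<alpha> - 1) / (2 * \<alpha>) = ?f r / ?g r"
    using eventually_at_right_less[of 0]
  proof eventually_elim
    case (elim r)
    have "r powr (2 * \<alpha> - 1) = r powr \<alpha> * r powr (\<alpha> - 1)"
      by (simp flip: powr_add)
    moreover have "?f r = r powr \<alpha> * (v r + c2 / r)"
      using elim by (simp add: powr_diff field_simps)
    ultimately show ?case using elim by simp
  qed
  show "((\<lambda>r. ?f r / ?g r) \<longlongrightarrow> - (c2 * (c2 + m) / (4 * c0 * \<alpha> * (1 - \<alpha>)))) (at_right 0)"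
    by (rule Lim_transform_eventually[OF _ ev]) (use lim in \<open>simp only: eq\<close>)
qed

section \<open>The logarithmic expansion for \<alpha> = 1\<close>

text \<open>Here r v' = Q + lam/2, and Q -> 0 because \<open>c2 = 0\<close>; comparison with -ln r,
  which tends to infinity, gives the limit.\<close>

lemma v_log_order:
  assumes "\<alpha> = 1" "c2 = 0"
  shows "((\<lambda>r. v r / (- ln r)) \<longlongrightarrow> - (lam / 2)) (at_right 0)"
proof (rule lhopital_right_0_at_top)
  let ?f = "\<lambda>r. r powr \<alpha> * Q r / r\<^sup>2 + c2 / r\<^sup>2 + \<alpha> * lam / (2 * r)"
  show "LIM r at_right 0. - ln r :> (at_top :: real filter)" by real_asymp
  show "\<forall>\<^sub>F r in at_right 0. - 1 / (r :: real) \<noteq> 0"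
    using eventually_at_right_less[of 0] by eventually_elim auto
  show "\<forall>\<^sub>F r in at_right 0. (v has_real_derivative ?f r) (at r)"
    using eventually_at_right_less[of 0] by eventually_elim (rule v_deriv)
  show "\<forall>\<^sub>F r in at_right 0. ((\<lambda>r::real. - ln r) has_real_derivative - 1 / r) (at r)"
    using eventually_at_right_less[of 0]
    by eventually_elim (auto intro!: derivative_eq_intros)
  have "((\<lambda>r. - Q r - lam / 2) \<longlongrightarrow> - (c2 * (c2 + m) / (2 * c0)) - lam / 2) (at_right 0)"
    by (intro tendsto_intros Q_lim)
  moreover have "\<forall>\<^sub>F r in at_right 0. - Q r - lam / 2 = ?f r / (- 1 / r)"
    using eventually_at_right_less[of 0]
    by eventually_elim (auto simp: assms field_simps power2_eq_square)
  ultimately show "((\<lambda>r. ?f r / (- 1 / r)) \<longlongrightarrow> - (lam / 2)) (at_right 0)"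
    using assms by (auto intro: Lim_transform_eventually)
qed

text \<open>Since w' = r v, the quotient of derivatives is that of \<open>v_log_order\<close>
  divided by 2 + 1 / ln r, which tends to 2.\<close>

lemma w_log_order:
  assumes "\<alpha> = 1" "c2 = 0"
  shows "((\<lambda>r. (w r - c0) / (r\<^sup>2 * (- ln r))) \<longlongrightarrow> - (lam / 4)) (at_right 0)"
proof (rule lhopital_right_0)
  let ?g = "\<lambda>r::real. r * (- ln r) * (2 + 1 / ln r)"
  \<comment> \<open>Below exp(-1) one has ln r < -1, so both ln r and 2 + 1 / ln r are
    nonzero.\<close>
  have small: "\<forall>\<^sub>F r in at_right 0. 0 < (r::real) \<and> r < exp (- 1)"
    using eventually_at_right_real[of 0 "exp (- 1)"] by (auto elim: eventually_mono)
  have ln: "ln r < - 1" if "0 < r" "r < exp (- 1)" for r :: real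
    using that ln_less_cancel_iff[of r "exp (- 1)"] by (simp del: ln_less_cancel_iff)
  have "((\<lambda>r. w r - c0) \<longlongrightarrow> c0 - c0) (at_right 0)"
    by (intro tendsto_intros w_lim)
  then show "((\<lambda>r. w r - c0) \<longlongrightarrow> 0) (at_right 0)" by simp
  show "((\<lambda>r::real. r\<^sup>2 * (- ln r)) \<longlongrightarrow> 0) (at_right 0)" by real_asymp
  show "\<forall>\<^sub>F r in at_right 0. (r::real)\<^sup>2 * (- ln r) \<noteq> 0"
    using small by eventually_elim (use ln in force)
  show "\<forall>\<^sub>F r in at_right 0. ?g r \<noteq> 0"
    using small
  proof eventually_elim
    case (elim r)
    then have l: "ln r < - 1" using ln by simp
    then have "2 + 1 / ln r > 0" by (simp add: field_simps)
    moreover have "r \<noteq> 1" using l by auto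
    ultimately show ?case using elim by simp
  qed
  show "\<forall>\<^sub>F r in at_right 0. ((\<lambda>r. w r - c0) has_real_derivative r powr \<alpha> * v r) (at r)"
    using small by eventually_elim (auto intro!: derivative_eq_intros w_deriv_v)
  show "\<forall>\<^sub>F r in at_right 0. ((\<lambda>r::real. r\<^sup>2 * (- ln r)) has_real_derivative ?g r) (at r)"
    using small
  proof eventually_elim
    case (elim r)
    then have "ln r \<noteq> 0" using ln by force
    then show ?case using elim
      by (auto intro!: derivative_eq_intros simp: field_simps power2_eq_square)
  qed
  have "((\<lambda>r::real. 2 + 1 / ln r) \<longlongrightarrow> 2) (at_right 0)" by real_asymp
  then have "((\<lambda>r. v r / (- ln r) / (2 + 1 / ln r)) \<longlongrightarrow> - (lam / 2) / 2) (at_right 0)"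
    by (intro tendsto_divide v_log_order assms) auto
  moreover have "\<forall>\<^sub>F r in at_right 0. v r / (- ln r) / (2 + 1 / ln r) =
      r powr \<alpha> * v r / ?g r"
    using small by eventually_elim (simp add: assms)
  ultimately show "((\<lambda>r. r powr \<alpha> * v r / ?g r) \<longlongrightarrow> - (lam / 4)) (at_right 0)"
    by (auto intro: Lim_transform_eventually)
qed

end

section \<open>From the soliton equation to the system\<close>

text \<open>Multiplying the equation for \<open>h\<close> by \<open>r\<^sup>2\<^sup>\<alpha>\<close>, the terms quadratic in \<open>w\<close> cancel because
  \<open>(\<alpha> + 1)\<^sup>2 = n\<close>.\<close>

lemma soliton_profileI:
  fixes n :: nat and \<alpha> lam c0 c2 :: real and h :: "real \<Rightarrow> real"
  assumes "n \<ge> 2" and \<alpha>: "\<alpha> = sqrt (real n) - 1" and "c0 > 0"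
    and c2: "c2 = (real n - 1) * (\<alpha> - 1) / 2"
    and C2: "C2_on_pos h" and ode: "soliton_ode n lam h"
    and lim: "((\<lambda>r. r powr \<alpha> * h r) \<longlongrightarrow> c0) (at_right 0)"
  shows "soliton_profile \<alpha> lam c0 c2 (real n - 1) (\<lambda>r. r powr \<alpha> * h r)
    (\<lambda>r. r * deriv h r + \<alpha> * h r)"
proof
  have nsq: "real n = (\<alpha> + 1)\<^sup>2" using \<alpha> by simp
  show "\<alpha> > 0" using assms(1) \<alpha> by simp
  show "c0 > 0" "((\<lambda>r. r powr \<alpha> * h r) \<longlongrightarrow> c0) (at_right 0)" by fact+
  fix r :: real assume r: "r > 0"
  show "r powr \<alpha> * h r > 0" using ode r by (simp add: soliton_ode_def)
  have dh: "(h has_real_derivative deriv h r) (at r)"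
    using C2 r unfolding C2_on_pos_def C1_differentiable_on_def
    by (metis DERIV_imp_deriv greaterThan_iff has_real_derivative_iff_has_vector_derivative)
  have ddh: "(deriv h has_real_derivative deriv (deriv h) r) (at r)"
    using C2 r unfolding C2_on_pos_def C1_differentiable_on_def
    by (metis DERIV_imp_deriv greaterThan_iff has_real_derivative_iff_has_vector_derivative)
  show "((\<lambda>r. r powr \<alpha> * h r) has_real_derivative r powr (\<alpha> - 1) * (r * deriv h r + \<alpha> * h r)) (at r)"
    using r by (auto intro!: derivative_eq_intros dh simp: powr_diff field_simps)
  let ?p = "deriv h r" and ?q = "deriv (deriv h) r"
  have h: "h r > 0" and eq: "2 * r^2 * h r * ?q =
          (real n - 1) * h r * (h r - 1) + r * ?p * (r * ?p - lam * r - (real n - 1))"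
    using ode r by (auto simp: soliton_ode_def)
  \<comment> \<open>The equation for y' with denominators cleared. After inserting
    \<open>eq\<close>, the terms linear in \<open>h r\<close> match by the choice of
    \<open>c2\<close>, and \<alpha> lam r / 2 absorbs the mixed term in \<open>lam\<close> and
    \<open>h r\<close>.\<close>
  have "2 * h r * (r * ((\<alpha> + 1) * ?p + r * ?q)) =
      2 * h r * (r * ?p + \<alpha> * h r) +
      (r * ?p + \<alpha> * h r - (real n - 1) - lam * r) * (r * ?p + \<alpha> * h r)
      + 2 * h r * (c2 + \<alpha> * lam * r / 2)"
    using eq unfolding c2 nsq by (simp add: field_simps power2_eq_square)
  then have "(\<alpha> + 1) * ?p + r * ?q = ((1 + (r * ?p + \<alpha> * h r - (real n - 1) - lam * r) / (2 * h r))
      * (r * ?p + \<alpha> * h r) + c2 + \<alpha> * lam * r / 2) / r"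
    using r h by (simp add: field_simps)
  moreover have "r powr \<alpha> * u / (2 * (r powr \<alpha> * h r)) = u / (2 * h r)" for u
    using r by simp
  moreover have "((\<lambda>r. r * deriv h r + \<alpha> * h r) has_real_derivative (\<alpha> + 1) * ?p + r * ?q) (at r)"
    by (auto intro!: derivative_eq_intros dh ddh simp: algebra_simps)
  ultimately show "((\<lambda>r. r * deriv h r + \<alpha> * h r) has_real_derivative
      ((1 + r powr \<alpha> * (r * ?p + \<alpha> * h r - (real n - 1) - lam * r) / (2 * (r powr \<alpha> * h r)))
      * (r * ?p + \<alpha> * h r) + c2 + \<alpha> * lam * r / 2) / r) (at r)"
    by simp
qed

section \<open>The expansions of \<open>h\<close> and its derivative\<close>

theorem theorem1p3:
  fixes n :: nat and \<alpha> lam c0 c1 c2 \<epsilon> :: real and h :: "real \<Rightarrow> real"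
  assumes "n \<in> {2, 3, 4}"
    and "\<alpha> = sqrt (real n) - 1"
    and "lam \<ge> 0"
    and "c0 > 0"
    and "c2 = (real n - 1) * (\<alpha> - 1) / 2"
    and "\<epsilon> > 0"
    and "soliton_solution n \<alpha> lam c0 c1 c2 \<epsilon> h"
    and "\<And>g r. soliton_solution n \<alpha> lam c0 c1 c2 \<epsilon> g \<Longrightarrow> r > 0 \<Longrightarrow> g r = h r"
  shows "\<exists>\<delta>0. 0 < \<delta>0 \<and> \<delta>0 < 1 \<and>
    (n \<in> {2, 3} \<longrightarrow>
      (\<exists>o1. (o1 \<longlongrightarrow> 0) (at_right 0) \<and>
        (\<forall>r. 0 < r \<and> r \<le> \<delta>0 \<longrightarrow>
          h r = 1 / r powr \<alpha> *
            (c0 - c2 / \<alpha> * r powr \<alpha>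
             - c2 * (c2 + real n - 1) / (4 * c0 * \<alpha> * (1 - \<alpha>)) * r powr (2 * \<alpha>)
             + o1 r * r powr (2 * \<alpha>)))) \<and>
      (\<exists>o2. (o2 \<longlongrightarrow> 0) (at_right 0) \<and>
        (\<forall>r. 0 < r \<and> r \<le> \<delta>0 \<longrightarrow>
          deriv h r = 1 / r powr (\<alpha> + 1) *
            (- \<alpha> * c0
             - c2 * (c2 + real n - 1) / (4 * c0 * (1 - \<alpha>)) * r powr (2 * \<alpha>)
             + o2 r * r powr (2 * \<alpha>))))) \<and>
    (n = 4 \<longrightarrow>
      (\<exists>o1. (o1 \<longlongrightarrow> 0) (at_right 0) \<and>
        (\<forall>r. 0 < r \<and> r \<le> \<delta>0 \<longrightarrow>
          h r = 1 / r * (c0 + lam / 4 * r^2 * ln r + o1 r * r^2 * \<bar>ln r\<bar>))) \<and>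
      (\<exists>o2. (o2 \<longlongrightarrow> 0) (at_right 0) \<and>
        (\<forall>r. 0 < r \<and> r \<le> \<delta>0 \<longrightarrow>
          deriv h r = 1 / r^2 * (- c0 + lam / 4 * r^2 * ln r + o2 r * r^2 * \<bar>ln r\<bar>))))"
proof -
  have h: "C2_on_pos h" "soliton_ode n lam h" "((\<lambda>r. r powr \<alpha> * h r) \<longlongrightarrow> c0) (at_right 0)"
    using assms(7) by (auto simp: soliton_solution_def)
  define w where "w r = r powr \<alpha> * h r" for r
  define y where "y r = r * deriv h r + \<alpha> * h r" for r
  interpret soliton_profile \<alpha> lam c0 c2 "real n - 1" w y
    unfolding w_def[abs_def] y_def[abs_def]
    using assms(1,4) by (intro soliton_profileI assms h) auto
  \<comment> \<open>Both \<open>h\<close> and its derivative are algebraic in \<open>w\<close> and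
    \<open>v\<close>, because r h' = y - \<alpha> h = r v - \<alpha> h. No asymptotic expansion has
    to be differentiated.\<close>
  have h_w: "h r = 1 / r powr \<alpha> * w r"
    and dh_w: "deriv h r = 1 / r powr (\<alpha> + 1) * (r powr (\<alpha> + 1) * v r - \<alpha> * w r)" if "r > 0" for r
    using that by (simp_all add: w_def v_def y_def powr_add field_simps)
  \<comment> \<open>The value 1/2 serves as \<open>\<delta>0\<close>: the error functions are exact
    remainders, defined by dividing by powers of r or by ln r, which is nonzero on (0, 1/2].\<close>
  have "\<exists>o1. (o1 \<longlongrightarrow> 0) (at_right 0) \<and>
        (\<forall>r. 0 < r \<and> r \<le> 1 / 2 \<longrightarrow>
          h r = 1 / r powr \<alpha> *
            (c0 - c2 / \<alpha> * r powr \<alpha>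
             - c2 * (c2 + real n - 1) / (4 * c0 * \<alpha> * (1 - \<alpha>)) * r powr (2 * \<alpha>)
             + o1 r * r powr (2 * \<alpha>)))"
    and "\<exists>o2. (o2 \<longlongrightarrow> 0) (at_right 0) \<and>
        (\<forall>r. 0 < r \<and> r \<le> 1 / 2 \<longrightarrow>
          deriv h r = 1 / r powr (\<alpha> + 1) *
            (- \<alpha> * c0
             - c2 * (c2 + real n - 1) / (4 * c0 * (1 - \<alpha>)) * r powr (2 * \<alpha>)
             + o2 r * r powr (2 * \<alpha>)))"
    if "n \<in> {2, 3}"
  proof -
    have "\<alpha> < 1"
      using that assms(2) by (auto simp: real_sqrt_less_iff[of _ 4, simplified])
    define E where "E = c2 * (c2 + (real n - 1)) / (4 * c0 * \<alpha> * (1 - \<alpha>))"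
    have E: "c2 * (c2 + real n - 1) / (4 * c0 * \<alpha> * (1 - \<alpha>)) = E"
      by (simp add: E_def algebra_simps)
    have \<alpha>E: "c2 * (c2 + real n - 1) / (4 * c0 * (1 - \<alpha>)) = \<alpha> * E"
      using \<alpha>_pos by (simp add: E_def add_diff_eq)
    define p where "p r = (w r - c0 + c2 / \<alpha> * r powr \<alpha>) / r powr (2 * \<alpha>)" for r
    define q where "q r = (v r + c2 / r) / r powr (\<alpha> - 1)" for r
    have p: "(p \<longlongrightarrow> - E) (at_right 0)"
      using w_second_order[OF \<open>\<alpha> < 1\<close>] by (simp add: p_def[abs_def] E_def)
    have "c2 * (c2 + (real n - 1)) / (2 * c0 * (1 - \<alpha>)) = 2 * \<alpha> * E"
      using \<alpha>_pos by (simp add: E_def)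
    then have q: "(q \<longlongrightarrow> - (2 * \<alpha> * E)) (at_right 0)"
      using v_second_order[OF \<open>\<alpha> < 1\<close>] by (simp add: q_def[abs_def])
    have w_p: "w r = c0 - c2 / \<alpha> * r powr \<alpha> + p r * r powr (2 * \<alpha>)" if "r > 0" for r
      using that by (simp add: p_def)
    have v_q: "r powr (\<alpha> + 1) * v r = - c2 * r powr \<alpha> + q r * r powr (2 * \<alpha>)" if "r > 0" for r
    proof -
      have "r powr (2 * \<alpha>) = r powr (\<alpha> + 1) * r powr (\<alpha> - 1)"
        by (simp flip: powr_add)
      then have "q r * r powr (2 * \<alpha>) = r powr (\<alpha> + 1) * (v r + c2 / r)"
        using that by (simp add: q_def)
      also have "\<dots> = r powr (\<alpha> + 1) * v r + r powr (\<alpha> + 1) * (c2 / r)"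
        by (rule distrib_left)
      also have "r powr (\<alpha> + 1) * (c2 / r) = c2 * r powr \<alpha>"
        using that by (simp add: powr_add)
      finally show ?thesis by simp
    qed
    show "\<exists>o1. (o1 \<longlongrightarrow> 0) (at_right 0) \<and>
        (\<forall>r. 0 < r \<and> r \<le> 1 / 2 \<longrightarrow>
          h r = 1 / r powr \<alpha> *
            (c0 - c2 / \<alpha> * r powr \<alpha>
             - c2 * (c2 + real n - 1) / (4 * c0 * \<alpha> * (1 - \<alpha>)) * r powr (2 * \<alpha>)
             + o1 r * r powr (2 * \<alpha>)))"
      unfolding E
    proof (intro exI[of _ "\<lambda>r. p r + E"] conjI allI impI)
      show "((\<lambda>r. p r + E) \<longlongrightarrow> 0) (at_right 0)"
        using tendsto_add[OF p tendsto_const[of E]] by simp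
    next
      fix r :: real assume r: "0 < r \<and> r \<le> 1 / 2"
      have "w r = c0 - c2 / \<alpha> * r powr \<alpha> - E * r powr (2 * \<alpha>) + (p r + E) * r powr (2 * \<alpha>)"
        using r by (simp add: w_p distrib_right)
      then show "h r = 1 / r powr \<alpha> *
          (c0 - c2 / \<alpha> * r powr \<alpha> - E * r powr (2 * \<alpha>) + (p r + E) * r powr (2 * \<alpha>))"
        using h_w[of r] r by simp
    qed
    show "\<exists>o2. (o2 \<longlongrightarrow> 0) (at_right 0) \<and>
        (\<forall>r. 0 < r \<and> r \<le> 1 / 2 \<longrightarrow>
          deriv h r = 1 / r powr (\<alpha> + 1) *
            (- \<alpha> * c0
             - c2 * (c2 + real n - 1) / (4 * c0 * (1 - \<alpha>)) * r powr (2 * \<alpha>)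
             + o2 r * r powr (2 * \<alpha>)))"
      unfolding \<alpha>E
    \<comment> \<open>The limits add up to -2 \<alpha> E + \<alpha> E + \<alpha> E = 0.\<close>
    proof (intro exI[of _ "\<lambda>r. q r - \<alpha> * p r + \<alpha> * E"] conjI allI impI)
      have "((\<lambda>r. q r - \<alpha> * p r + \<alpha> * E) \<longlongrightarrow> - (2 * \<alpha> * E) - \<alpha> * - E + \<alpha> * E) (at_right 0)"
        by (intro tendsto_intros p q)
      then show "((\<lambda>r. q r - \<alpha> * p r + \<alpha> * E) \<longlongrightarrow> 0) (at_right 0)" by simp
    next
      fix r :: real assume r: "0 < r \<and> r \<le> 1 / 2"
      \<comment> \<open>The terms c2 r^\<alpha> from \<open>v\<close> and from \<alpha> w cancel, so
        the derivative has no term of that order.\<close>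
      have "r powr (\<alpha> + 1) * v r - \<alpha> * w r =
          - \<alpha> * c0 - \<alpha> * E * r powr (2 * \<alpha>) + (q r - \<alpha> * p r + \<alpha> * E) * r powr (2 * \<alpha>)"
        using r \<alpha>_pos unfolding w_p[OF conjunct1[OF r]] v_q[OF conjunct1[OF r]]
        by (simp add: algebra_simps)
      then show "deriv h r = 1 / r powr (\<alpha> + 1) *
          (- \<alpha> * c0 - \<alpha> * E * r powr (2 * \<alpha>) + (q r - \<alpha> * p r + \<alpha> * E) * r powr (2 * \<alpha>))"
        using dh_w[of r] r by simp
    qed
  qed
  moreover have "\<exists>o1. (o1 \<longlongrightarrow> 0) (at_right 0) \<and>
        (\<forall>r. 0 < r \<and> r \<le> 1 / 2 \<longrightarrow>
          h r = 1 / r * (c0 + lam / 4 * r^2 * ln r + o1 r * r^2 * \<bar>ln r\<bar>))"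
    and "\<exists>o2. (o2 \<longlongrightarrow> 0) (at_right 0) \<and>
        (\<forall>r. 0 < r \<and> r \<le> 1 / 2 \<longrightarrow>
          deriv h r = 1 / r^2 * (- c0 + lam / 4 * r^2 * ln r + o2 r * r^2 * \<bar>ln r\<bar>))"
    if "n = 4"
  proof -
    have \<alpha>: "\<alpha> = 1" and "c2 = 0" using that assms(2,5) by auto
    define p where "p r = (w r - c0) / (r\<^sup>2 * (- ln r))" for r
    define q where "q r = v r / (- ln r)" for r
    have p: "(p \<longlongrightarrow> - (lam / 4)) (at_right 0)" and q: "(q \<longlongrightarrow> - (lam / 2)) (at_right 0)"
      using w_log_order v_log_order \<alpha> \<open>c2 = 0\<close> by (simp_all add: p_def[abs_def] q_def[abs_def])
    have ln: "ln r < 0" if "0 < r \<and> r \<le> 1 / 2" for r :: real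
      using that by simp
    have w_p: "w r = c0 - p r * r\<^sup>2 * ln r" and v_q: "v r = - q r * ln r"
      if "0 < r \<and> r \<le> 1 / 2" for r
      using ln[OF that] that by (simp_all add: p_def q_def)
    show "\<exists>o1. (o1 \<longlongrightarrow> 0) (at_right 0) \<and>
        (\<forall>r. 0 < r \<and> r \<le> 1 / 2 \<longrightarrow>
          h r = 1 / r * (c0 + lam / 4 * r^2 * ln r + o1 r * r^2 * \<bar>ln r\<bar>))"
    \<comment> \<open>As ln r is negative, |ln r| = -ln r, and the \<open>lam\<close> part of this
      remainder cancels the explicit logarithmic term, leaving \<open>w_p\<close>.\<close>
    proof (intro exI[of _ "\<lambda>r. p r + lam / 4"] conjI allI impI)
      show "((\<lambda>r. p r + lam / 4) \<longlongrightarrow> 0) (at_right 0)"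
        using tendsto_add[OF p tendsto_const[of "lam / 4"]] by simp
      fix r :: real assume r: "0 < r \<and> r \<le> 1 / 2"
      have "w r = c0 + lam / 4 * r^2 * ln r + (p r + lam / 4) * r^2 * \<bar>ln r\<bar>"
        using ln[OF r] w_p[OF r] by (simp add: algebra_simps)
      then show "h r = 1 / r * (c0 + lam / 4 * r^2 * ln r + (p r + lam / 4) * r^2 * \<bar>ln r\<bar>)"
        using h_w[of r] r \<alpha> by simp
    qed
    show "\<exists>o2. (o2 \<longlongrightarrow> 0) (at_right 0) \<and>
        (\<forall>r. 0 < r \<and> r \<le> 1 / 2 \<longrightarrow>
          deriv h r = 1 / r^2 * (- c0 + lam / 4 * r^2 * ln r + o2 r * r^2 * \<bar>ln r\<bar>))"
    \<comment> \<open>The coefficient lam/4 is lam/2 from \<open>v\<close> minus lam/4 from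
      \<open>w\<close>.\<close>
    proof (intro exI[of _ "\<lambda>r. q r - p r + lam / 4"] conjI allI impI)
      have "((\<lambda>r. q r - p r + lam / 4) \<longlongrightarrow> - (lam / 2) - - (lam / 4) + lam / 4) (at_right 0)"
        by (intro tendsto_intros p q)
      then show "((\<lambda>r. q r - p r + lam / 4) \<longlongrightarrow> 0) (at_right 0)" by simp
      fix r :: real assume r: "0 < r \<and> r \<le> 1 / 2"
      have "r\<^sup>2 * v r - w r = - c0 + lam / 4 * r^2 * ln r + (q r - p r + lam / 4) * r^2 * \<bar>ln r\<bar>"
        using ln[OF r] w_p[OF r] v_q[OF r] by (simp add: algebra_simps)
      moreover have "deriv h r = 1 / r\<^sup>2 * (r\<^sup>2 * v r - w r)"
        using dh_w[of r] r \<alpha> by simp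
      ultimately show "deriv h r =
          1 / r^2 * (- c0 + lam / 4 * r^2 * ln r + (q r - p r + lam / 4) * r^2 * \<bar>ln r\<bar>)"
        by simp
    qed
  qed
  ultimately show ?thesis
    by (intro exI[of _ "1 / 2"]) simp
qed

end
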